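(* Let $m\ge2$ be an integer and $p$ a prime. Let $G$ be the additive group of roots of $X^{p^m}+X^p+X$ in its splitting field over $\mathbb{F}_p$, let $H=\mathbb{F}_{p^m}^\times$, let $\mathbb{F}$ be a finite field of characteristic $p$ containing both $G$ and $H$, and regard $G$ and $H$ as groups of translations and scalings in $\mathrm{AGL}(1,\mathbb{F})$. Let $T$ be the normalized bi-adjacency operator of the coset graph $\mathsf{B}(G,H)$. Then its second largest singular value satisfies $$\sigma_2(T)\ \le\ \sqrt{\frac1p+\frac{1}{p^m-1}}.$$
   Context: $\mathrm{AGL}(1,\mathbb{F})=\{x\mapsto ax+b: a\in\mathbb{F}^\times,b\in\mathbb{F}\}$. The additive subgroup $G\le(\mathbb{F},+)$ is identified with $\{x\mapsto x+a:a\in G\}$ and the multiplicative subgroup $H\le\mathbb{F}^\times$ with $\{x\mapsto hx:h\in H\}$; $A=\langle G,H\rangle\le\mathrm{AGL}(1,\mathbb{F})$ is the group they generate. $A/G$ and $A/H$ denote the sets of right cosets $\{G\phi:\phi\in A\}$ and $\{H\phi:\phi\in A\}$. The bipartite coset graph $\mathsf{B}(G,H)$ has left vertex set $A/G$, right vertex set $A/H$, and one edge for each $\phi\in A$, joining $G\phi$ and $H\phi$. Its bi-adjacency matrix $\mathsf{B}$ has $(G\phi,H\psi)$ entry $|G\phi\cap H\psi|$. The normalized operator is $T=\frac{1}{\sqrt{|G||H|}}\mathsf{B}:\ell_2(A/H)\to\ell_2(A/G)$. Its largest singular value is $1$, attained on the constant function $\mathbf{1}$, and $\sigma_2(T)=\sup\{\|Tf\|: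 f\in\ell_2(A/H),\ f\perp\mathbf{1},\ \|f\|=1\}$. *)

theory Defs
  imports
    "HOL-Analysis.Analysis"
    "HOL-Algebra.Coset"
    "HOL-Algebra.Generated_Groups"
    "HOL-Algebra.Algebraic_Closure_Type"
begin

subsection \<open>The affine group of a field\<close>

text \<open>The product is composition of maps, so \<open>G #> \<phi>\<close> is \<open>{g \<circ> \<phi> | g \<in> G}\<close>.\<close>

definition AGL1 :: "('a::field \<Rightarrow> 'a) monoid" where
  "AGL1 = \<lparr>carrier = {\<lambda>x. a * x + b | a b. a \<noteq> 0}, mult = (\<circ>), one = id\<rparr>"

definition translation_maps :: "'a::field set \<Rightarrow> ('a \<Rightarrow> 'a) set" where
  "translation_maps S = (\<lambda>a x. x + a) ` S"

definition scaling_maps :: "'a::field set \<Rightarrow> ('a \<Rightarrow> 'a) set" where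
  "scaling_maps S = (\<lambda>h x. h * x) ` S"

lemma AGL1_I: "a \<noteq> 0 \<Longrightarrow> (\<lambda>x. a * x + b) \<in> carrier AGL1"
  unfolding AGL1_def by auto

lemma group_AGL1: "group (AGL1 :: ('a::field \<Rightarrow> 'a) monoid)"
proof (rule groupI)
  fix f g :: "'a \<Rightarrow> 'a"
  assume "f \<in> carrier AGL1" "g \<in> carrier AGL1"
  then obtain a b c d where "f = (\<lambda>x. a * x + b)" "a \<noteq> 0" "g = (\<lambda>x. c * x + d)" "c \<noteq> 0"
    by (auto simp: AGL1_def)
  then have "f \<otimes>\<^bsub>AGL1\<^esub> g = (\<lambda>x. (a * c) * x + (a * d + b))" "a * c \<noteq> 0"
    by (auto simp: AGL1_def fun_eq_iff algebra_simps)
  then show "f \<otimes>\<^bsub>AGL1\<^esub> g \<in> carrier AGL1"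
    using AGL1_I by metis
next
  have "\<one>\<^bsub>AGL1\<^esub> = (\<lambda>x::'a. 1 * x + 0)"
    by (auto simp: AGL1_def)
  then show "\<one>\<^bsub>AGL1\<^esub> \<in> carrier (AGL1 :: ('a \<Rightarrow> 'a) monoid)"
    using AGL1_I[of "1::'a" 0] by simp
next
  fix f :: "'a \<Rightarrow> 'a"
  assume "f \<in> carrier AGL1"
  then obtain a b where f: "f = (\<lambda>x. a * x + b)" "a \<noteq> 0"
    by (auto simp: AGL1_def)
  have "(\<lambda>x. inverse a * x + (- inverse a * b)) \<otimes>\<^bsub>AGL1\<^esub> f = \<one>\<^bsub>AGL1\<^esub>"
    using f by (auto simp: AGL1_def fun_eq_iff field_simps)
  moreover have "(\<lambda>x. inverse a * x + (- inverse a * b)) \<in> carrier AGL1"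
    by (rule AGL1_I) (simp add: f(2))
  ultimately show "\<exists>g\<in>carrier AGL1. g \<otimes>\<^bsub>AGL1\<^esub> f = \<one>\<^bsub>AGL1\<^esub>"
    by blast
qed (auto simp: AGL1_def o_assoc)

subsection \<open>Coset graphs\<close>

text \<open>Parallel edges are allowed: an edge is an object of its own, with a left and a right end.\<close>

record ('u, 'v, 'e) bipartite_multigraph =
  left_verts :: "'u set"
  right_verts :: "'v set"
  edges :: "'e set"
  left_end :: "'e \<Rightarrow> 'u"
  right_end :: "'e \<Rightarrow> 'v"

definition biadjacency :: "('u, 'v, 'e) bipartite_multigraph \<Rightarrow> 'u \<Rightarrow> 'v \<Rightarrow> nat" where
  "biadjacency B u v = card {e \<in> edges B. left_end B e = u \<and> right_end B e = v}"

definition coset_graph ::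
    "('g, 'm) monoid_scheme \<Rightarrow> 'g set \<Rightarrow> 'g set \<Rightarrow> ('g set, 'g set, 'g) bipartite_multigraph" where
  "coset_graph A G H =
     \<lparr>left_verts = rcosets\<^bsub>A\<^esub> G, right_verts = rcosets\<^bsub>A\<^esub> H, edges = carrier A,
      left_end = (\<lambda>\<phi>. G #>\<^bsub>A\<^esub> \<phi>), right_end = (\<lambda>\<phi>. H #>\<^bsub>A\<^esub> \<phi>)\<rparr>"

text \<open>The matrix entries are the sizes of the intersections of cosets.\<close>

lemma biadjacency_coset_graph:
  assumes "group A" "subgroup G A" "subgroup H A"
    and "U \<in> rcosets\<^bsub>A\<^esub> G" "V \<in> rcosets\<^bsub>A\<^esub> H"
  shows "biadjacency (coset_graph A G H) U V = card (U \<inter> V)"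
proof -
  interpret group A by fact
  have coset: "\<phi> \<in> W \<longleftrightarrow> \<phi> \<in> carrier A \<and> K #>\<^bsub>A\<^esub> \<phi> = W"
    if K: "subgroup K A" and W: "W \<in> rcosets\<^bsub>A\<^esub> K" for K W \<phi>
  proof
    assume "\<phi> \<in> W"
    obtain a where a: "a \<in> carrier A" "W = K #>\<^bsub>A\<^esub> a"
      using W by (auto simp: RCOSETS_def)
    then show "\<phi> \<in> carrier A \<and> K #>\<^bsub>A\<^esub> \<phi> = W"
      using \<open>\<phi> \<in> W\<close> K repr_independence r_coset_subset_G subgroup.subset by blast
  next
    assume "\<phi> \<in> carrier A \<and> K #>\<^bsub>A\<^esub> \<phi> = W"
    then show "\<phi> \<in> W" using K rcos_self by blast
  qed
  have "{\<phi> \<in> carrier A. G #>\<^bsub>A\<^esub> \<phi> = U \<and> H #>\<^bsub>A\<^esub> \<phi> = V} = U \<inter> V"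
    using coset[OF assms(2,4)] coset[OF assms(3,5)] by blast
  then show ?thesis by (simp add: biadjacency_def coset_graph_def)
qed

subsection \<open>The normalized operator and its second singular value\<close>

text \<open>
  An element of \<open>\<ell>\<^sub>2(S)\<close>, for finite \<open>S\<close>, is represented by a function on the whole type of which
  only the values on \<open>S\<close> matter.
\<close>

definition l2_inner :: "'x set \<Rightarrow> ('x \<Rightarrow> complex) \<Rightarrow> ('x \<Rightarrow> complex) \<Rightarrow> complex" where
  "l2_inner S f g = (\<Sum>x\<in>S. f x * cnj (g x))"

definition l2_norm :: "'x set \<Rightarrow> ('x \<Rightarrow> complex) \<Rightarrow> real" where
  "l2_norm S f = L2_set (\<lambda>x. cmod (f x)) S"

definition normalized_op ::
    "('g, 'm) monoid_scheme \<Rightarrow> 'g set \<Rightarrow> 'g set \<Rightarrow> ('g set \<Rightarrow> complex) \<Rightarrow> 'g set \<Rightarrow> complex" where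
  "normalized_op A G H f U =
     complex_of_real (1 / sqrt (real (card G) * real (card H))) *
     (\<Sum>V\<in>right_verts (coset_graph A G H). of_nat (biadjacency (coset_graph A G H) U V) * f V)"

text \<open>
  The supremum is one of real numbers; it is meaningful when \<open>S\<close> is finite with at least two
  elements and \<open>R\<close> is finite, so that the set of values is nonempty and, for linear \<open>T\<close>, bounded.
\<close>

definition sigma2 :: "'x set \<Rightarrow> 'y set \<Rightarrow> (('x \<Rightarrow> complex) \<Rightarrow> ('y \<Rightarrow> complex)) \<Rightarrow> real" where
  "sigma2 S R T = Sup {l2_norm R (T f) | f. l2_inner S f (\<lambda>_. 1) = 0 \<and> l2_norm S f = 1}"

definition coset_graph_sigma2 :: "('g, 'm) monoid_scheme \<Rightarrow> 'g set \<Rightarrow> 'g set \<Rightarrow> real" where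
  "coset_graph_sigma2 A G H =
     sigma2 (right_verts (coset_graph A G H)) (left_verts (coset_graph A G H)) (normalized_op A G H)"

subsection \<open>Splitting of polynomials\<close>

definition splits :: "'a::field poly \<Rightarrow> bool" where
  "splits P \<longleftrightarrow> (\<exists>as. P = Polynomial.smult (Polynomial.lead_coeff P) (\<Prod>a\<leftarrow>as. [:- a, 1:]))"

end

theory Submission
  imports Defs
begin

text \<open>
  Let \<open>V\<close> be the \<open>K\<close>-span of \<open>G\<close> and \<open>q = card K\<close>. Then \<open>A\<close> consists of the maps \<open>x \<mapsto> h (x + w)\<close> with
  \<open>h \<in> H\<close>, \<open>w \<in> V\<close>, functions on \<open>A/H\<close> are functions \<open>f\<close> on \<open>V\<close>, and \<open>\<parallel>T f\<parallel>\<^sup>2\<close> is the mean over \<open>h \<in> H\<close> of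
  \<open>\<parallel>P\<^sub>h f\<parallel>\<^sup>2\<close>, where \<open>P\<^sub>h\<close> averages over translations by \<open>h G\<close>. The \<open>P\<^sub>h\<close> are commuting orthogonal projections.
  If \<open>P\<^sub>k u = 0\<close>, then for each \<open>h\<close> the \<open>p\<close> functions \<open>P u\<close> with factors \<open>h + j k\<close>, \<open>j < p\<close>, are pairwise
  orthogonal, so Bessel's inequality, summed over \<open>h \<in> K\<close>, bounds the sum of all \<open>\<parallel>P\<^sub>h u\<parallel>\<^sup>2\<close> by \<open>(q / p) \<parallel>u\<parallel>\<^sup>2\<close>.
  Splitting \<open>f\<close> successively by all \<open>P\<^sub>k\<close> gives the same bound for \<open>f\<close> up to the contribution of the
  \<open>V\<close>-invariant part, which vanishes when \<open>f\<close> is orthogonal to the constants. Hence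
  \<open>\<parallel>T f\<parallel>\<^sup>2 \<le> q / (p (q - 1)) \<parallel>f\<parallel>\<^sup>2\<close>.
\<close>

section \<open>Finite-dimensional inner products and Bessel's inequality\<close>

definition sq_norm :: "('x::finite \<Rightarrow> complex) \<Rightarrow> real" where
  "sq_norm f = (\<Sum>x\<in>UNIV. (cmod (f x))\<^sup>2)"

lemma l2_inner_self: "l2_inner UNIV f f = of_real (sq_norm f)"
  by (simp add: l2_inner_def sq_norm_def complex_norm_square del: of_real_power)

lemma l2_inner_diff_left: "l2_inner S (\<lambda>x. f x - g x) h = l2_inner S f h - l2_inner S g h"
  and l2_inner_diff_right: "l2_inner S h (\<lambda>x. f x - g x) = l2_inner S h f - l2_inner S h g"
  by (simp_all add: l2_inner_def algebra_simps sum_subtractf)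

lemma l2_inner_sum_left: "l2_inner S (\<lambda>x. \<Sum>j\<in>J. f j x) h = (\<Sum>j\<in>J. l2_inner S (f j) h)"
  by (simp add: l2_inner_def sum_distrib_right sum.swap[of _ S])

lemma l2_inner_sum_right: "l2_inner S h (\<lambda>x. \<Sum>j\<in>J. f j x) = (\<Sum>j\<in>J. l2_inner S h (f j))"
  by (simp add: l2_inner_def sum_distrib_left sum.swap[of _ S])

lemma sq_norm_nonneg: "0 \<le> sq_norm f"
  by (simp add: sq_norm_def sum_nonneg)

text \<open>With \<open>s\<close> the sum of the \<open>v j\<close>, both inner products of
  \<open>u\<close> with \<open>s\<close> and that of \<open>s\<close> with itself equal
  \<open>t\<close>, so the squared norm of \<open>u - s\<close> is \<open>sq_norm u - t\<close>,
  which is nonnegative. The hypothesis \<open>proj\<close> is what holds when \<open>v j\<close> is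
  an orthogonal projection of \<open>u\<close>.\<close>

lemma bessel:
  fixes u :: "'x::finite \<Rightarrow> complex"
  assumes fin: "finite J"
    and proj: "\<And>j. j \<in> J \<Longrightarrow> l2_inner UNIV u (v j) = of_real (sq_norm (v j))"
    and orth: "\<And>i j. i \<in> J \<Longrightarrow> j \<in> J \<Longrightarrow> i \<noteq> j \<Longrightarrow> l2_inner UNIV (v i) (v j) = 0"
  shows "(\<Sum>j\<in>J. sq_norm (v j)) \<le> sq_norm u"
proof -
  define s where "s x = (\<Sum>j\<in>J. v j x)" for x
  define t where "t = (\<Sum>j\<in>J. sq_norm (v j))"
  have us: "l2_inner UNIV u s = of_real t"
    unfolding s_def l2_inner_sum_right t_def using proj by simp
  have "l2_inner UNIV s u = cnj (l2_inner UNIV u s)"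
    by (simp add: l2_inner_def mult.commute)
  then have su: "l2_inner UNIV s u = of_real t"
    by (simp add: us)
  have "l2_inner UNIV (v i) s = of_real (sq_norm (v i))" if "i \<in> J" for i
  proof -
    have "l2_inner UNIV (v i) s = (\<Sum>j\<in>J. if j = i then of_real (sq_norm (v i)) else 0)"
      unfolding s_def l2_inner_sum_right using orth that
      by (intro sum.cong) (auto simp: l2_inner_self)
    then show ?thesis using that fin by simp
  qed
  then have ss: "l2_inner UNIV s s = of_real t"
    using l2_inner_sum_left[of UNIV v J s] by (simp add: t_def flip: s_def)
  have "complex_of_real (sq_norm (\<lambda>x. u x - s x)) = of_real (sq_norm u - t)"
    by (simp add: l2_inner_self[symmetric] l2_inner_diff_left l2_inner_diff_right us su ss)
  then have "sq_norm (\<lambda>x. u x - s x) = sq_norm u - t"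
    using of_real_eq_iff by blast
  then show ?thesis
    using sq_norm_nonneg[of "\<lambda>x. u x - s x"] by (simp add: t_def)
qed

subsection \<open>Averages over dilates of an additive subgroup\<close>

text \<open>Serves three sets: the translation group \<open>G\<close>, the subfield \<open>K\<close>
  of factors, and the span \<open>V\<close>.\<close>

locale add_subgroup =
  fixes G :: "'a::{field,finite} set"
  assumes zero_mem: "0 \<in> G"
    and diff_mem: "x \<in> G \<Longrightarrow> y \<in> G \<Longrightarrow> x - y \<in> G"
begin

lemma uminus_mem: "x \<in> G \<Longrightarrow> - x \<in> G"
  using diff_mem[OF zero_mem] by simp

lemma add_mem: "x \<in> G \<Longrightarrow> y \<in> G \<Longrightarrow> x + y \<in> G"
  using diff_mem[of x "- y"] uminus_mem by simp

lemma of_nat_mult_mem: "x \<in> G \<Longrightarrow> of_nat n * x \<in> G"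
  by (induction n) (auto simp: zero_mem add_mem algebra_simps)

lemma of_int_mult_mem: "x \<in> G \<Longrightarrow> of_int i * x \<in> G"
  by (cases i) (use of_nat_mult_mem uminus_mem in \<open>fastforce simp del: of_nat_Suc\<close>)+

lemma card_pos: "card G > 0"
  using zero_mem by (auto simp: card_gt_0_iff)

lemma sum_shift:
  assumes "a \<in> G"
  shows "(\<Sum>x\<in>G. f (x + a)) = (\<Sum>x\<in>G. f x)"
  by (rule sum.reindex_bij_witness[of _ "\<lambda>x. x - a" "\<lambda>x. x + a"]) (auto simp: assms add_mem diff_mem)

end

text \<open>For an additive subgroup \<open>G\<close> this is the orthogonal projection onto the
  functions invariant under \<open>h G\<close>. The factor 0 gives the identity.\<close>

definition dilate_avg :: "'a::{field,finite} set \<Rightarrow> 'a \<Rightarrow> ('a \<Rightarrow> complex) \<Rightarrow> 'a \<Rightarrow> complex" where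
  "dilate_avg G h f w = (\<Sum>g\<in>G. f (w + h * g)) / of_nat (card G)"

text \<open>Translations commute. Two sets are allowed so that averages over dilates of
  \<open>G\<close> can be exchanged with the mean over \<open>V\<close>.\<close>

lemma dilate_avg_commute: "dilate_avg G h (dilate_avg L k f) = dilate_avg L k (dilate_avg G h f)"
  by (simp add: dilate_avg_def fun_eq_iff sum_divide_distrib[symmetric] sum.swap[of _ G L] add_ac)

lemma dilate_avg_diff:
  "dilate_avg G h (\<lambda>w. f w - g w) = (\<lambda>w. dilate_avg G h f w - dilate_avg G h g w)"
  by (simp add: dilate_avg_def fun_eq_iff sum_subtractf diff_divide_distrib)

lemma dilate_avg_zero: "dilate_avg G h (\<lambda>w. 0) = (\<lambda>w. 0)"
  by (simp add: dilate_avg_def fun_eq_iff)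

context add_subgroup
begin

lemma dilate_avg_invariant: "g \<in> G \<Longrightarrow> dilate_avg G h f (w + h * g) = dilate_avg G h f w"
  using sum_shift[of g "\<lambda>x. f (w + h * x)"] by (simp add: dilate_avg_def algebra_simps)

lemma dilate_avg_eqI:
  assumes "\<And>g w. g \<in> G \<Longrightarrow> f (w + h * g) = f w"
  shows "dilate_avg G h f = f"
  using assms zero_mem by (auto simp: dilate_avg_def fun_eq_iff)

lemma dilate_avg_idem: "dilate_avg G h (dilate_avg G h f) = dilate_avg G h f"
  by (rule dilate_avg_eqI) (rule dilate_avg_invariant)

lemma dilate_avg_self_adjoint:
  "l2_inner UNIV (dilate_avg G h f) g = l2_inner UNIV f (dilate_avg G h g)"
proof -
  have "(\<Sum>w\<in>UNIV. \<Sum>x\<in>G. f (w + h * x) * cnj (g w)) = (\<Sum>x\<in>G. \<Sum>w\<in>UNIV. f (w + h * x) * cnj (g w))"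
    by (rule sum.swap)
  \<comment> \<open>Substituting \<open>w - h * x\<close> for \<open>w\<close> moves the translation
    to the other factor; the sign is then absorbed because \<open>G\<close> is closed under
    negation.\<close>
  also have "\<dots> = (\<Sum>x\<in>G. \<Sum>w\<in>UNIV. f w * cnj (g (w + h * - x)))"
  proof (rule sum.cong[OF refl])
    fix x
    show "(\<Sum>w\<in>UNIV. f (w + h * x) * cnj (g w)) = (\<Sum>w\<in>UNIV. f w * cnj (g (w + h * - x)))"
      by (rule sum.reindex_bij_witness[of _ "\<lambda>w. w - h * x" "\<lambda>w. w + h * x"]) auto
  qed
  also have "\<dots> = (\<Sum>x\<in>G. \<Sum>w\<in>UNIV. f w * cnj (g (w + h * x)))"
    by (rule sum.reindex_bij_witness[of _ uminus uminus]) (auto simp: uminus_mem)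
  also have "\<dots> = (\<Sum>w\<in>UNIV. \<Sum>x\<in>G. f w * cnj (g (w + h * x)))"
    by (rule sum.swap)
  finally show ?thesis
    by (simp add: l2_inner_def dilate_avg_def sum_divide_distrib[symmetric] sum_distrib_right sum_distrib_left)
qed

text \<open>Idempotence and self-adjointness together; this supplies the hypothesis
  \<open>proj\<close> of \<open>bessel\<close>.\<close>

lemma l2_inner_dilate_avg: "l2_inner UNIV u (dilate_avg G h u) = of_real (sq_norm (dilate_avg G h u))"
  by (metis dilate_avg_idem dilate_avg_self_adjoint l2_inner_self)

text \<open>Pythagoras for an orthogonal projection and its complement.\<close>

lemma sq_norm_dilate_avg_split:
  "sq_norm f = sq_norm (dilate_avg G h f) + sq_norm (\<lambda>w. f w - dilate_avg G h f w)"
proof -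
  let ?P = "dilate_avg G h f"
  have "l2_inner UNIV ?P f = of_real (sq_norm ?P)"
    by (simp add: dilate_avg_self_adjoint l2_inner_dilate_avg)
  then have "complex_of_real (sq_norm (\<lambda>w. f w - ?P w)) = of_real (sq_norm f - sq_norm ?P)"
    by (simp add: l2_inner_self[symmetric] l2_inner_diff_left l2_inner_diff_right l2_inner_dilate_avg)
  then have "sq_norm (\<lambda>w. f w - ?P w) = sq_norm f - sq_norm ?P"
    using of_real_eq_iff by blast
  then show ?thesis by simp
qed

text \<open>
  A function fixed by the averages with factors \<open>h + i k\<close> and \<open>h + j k\<close> is invariant under \<open>(i - j) k G\<close>,
  which is \<open>k G\<close> because \<open>i - j\<close> is invertible modulo \<open>p\<close>.
\<close>

lemma dilate_avg_orthogonal: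
  assumes p: "Factorial_Ring.prime p" "CHAR('a) = p" and u: "dilate_avg G k u = (\<lambda>w. 0)"
    and ij: "i < p" "j < p" "i \<noteq> j"
  shows "l2_inner UNIV (dilate_avg G (h + of_nat i * k) u) (dilate_avg G (h + of_nat j * k) u) = 0"
proof -
  let ?P = "\<lambda>n. dilate_avg G (h + of_nat n * k)"
  define v where "v = ?P i (?P j u)"
  have vi: "v (w + (h + of_nat i * k) * g) = v w" if "g \<in> G" for g w
    unfolding v_def using that by (rule dilate_avg_invariant)
  have vj: "v (w + (h + of_nat j * k) * g) = v w" if "g \<in> G" for g w
    unfolding v_def dilate_avg_commute[of G "h + of_nat i * k"] using that by (rule dilate_avg_invariant)
  have "\<not> int p dvd int i - int j"
    using ij by (auto dest!: zdvd_imp_le[rotated] simp: dvd_diff_commute) (smt (verit) zdvd_not_zless ij dvd_diff_commute of_nat_less_iff of_nat_0_le_iff of_nat_eq_iff)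
  then have "coprime (int i - int j) (int p)"
    using p(1) by (metis coprime_commute prime_imp_coprime prime_nat_int_transfer)
  \<comment> \<open>The Bezout coefficient \<open>n\<close> becomes the inverse of
    \<open>i - j\<close> in the field, where \<open>p\<close> vanishes.\<close>
  then obtain n l where n: "n * (int i - int j) + l * int p = 1"
    by (metis bezout_int coprime_imp_gcd_eq_1)
  have "of_int (n * (int i - int j) + l * int p) = (1::'a)"
    unfolding n by simp
  then have unit: "(of_nat i - of_nat j) * of_int n = (1::'a)"
    using p(2) of_nat_CHAR[where 'a = 'a] by (simp add: mult.commute)
  have "dilate_avg G k v = v"
  proof (rule dilate_avg_eqI)
    fix g w assume "g \<in> G"
    then have g: "of_int n * g \<in> G" by (rule of_int_mult_mem)
    let ?g = "of_int n * g"
    have "k * g = (of_nat i - of_nat j) * of_int n * (k * g)"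
      by (simp add: unit)
    \<comment> \<open>A shift by \<open>k g\<close> is one with factor \<open>h + i k\<close> minus
      one with factor \<open>h + j k\<close>, both applied to \<open>n g\<close>; the terms in
      \<open>h\<close> cancel.\<close>
    then have *: "w + k * g = (w + (h + of_nat i * k) * ?g) + (h + of_nat j * k) * - ?g"
      by (simp add: algebra_simps)
    show "v (w + k * g) = v w"
      unfolding * using vi[OF g] vj[OF uminus_mem[OF g]] by simp
  qed
  \<comment> \<open>The average with factor \<open>k\<close> commutes past the other two and
    annihilates \<open>u\<close>.\<close>
  moreover have "dilate_avg G k v = (\<lambda>w. 0)"
    unfolding v_def by (simp add: dilate_avg_commute[of G k] u dilate_avg_zero)
  ultimately have "v = (\<lambda>w. 0)" by simp
  moreover have "l2_inner UNIV (?P i u) (?P j u) = l2_inner UNIV u v"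
    by (simp add: v_def dilate_avg_self_adjoint)
  ultimately show ?thesis by (simp add: l2_inner_def)
qed

lemma sum_sq_norm_dilate_avg_le_of_null:
  assumes p: "Factorial_Ring.prime p" "CHAR('a) = p"
    and K: "add_subgroup K" "k \<in> K" and u: "dilate_avg G k u = (\<lambda>w. 0)"
  shows "(\<Sum>h\<in>K. sq_norm (dilate_avg G h u)) \<le> real (card K) / real p * sq_norm u"
proof -
  interpret K: add_subgroup K by fact
  let ?N = "\<lambda>h. sq_norm (dilate_avg G h u)"
  \<comment> \<open>For each \<open>j\<close>, adding \<open>j k\<close> permutes \<open>K\<close>,
    so the sum may be written \<open>p\<close> times with shifted factors; Bessel then applies for
    each fixed \<open>h\<close>.\<close>
  have "real p * (\<Sum>h\<in>K. ?N h) = (\<Sum>j<p. \<Sum>h\<in>K. ?N (h + of_nat j * k))"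
    using K.sum_shift[of _ ?N] K.of_nat_mult_mem[OF K(2)] by simp
  also have "\<dots> = (\<Sum>h\<in>K. \<Sum>j<p. ?N (h + of_nat j * k))"
    by (rule sum.swap)
  also have "\<dots> \<le> (\<Sum>h\<in>K. sq_norm u)"
    by (intro sum_mono bessel) (auto simp: l2_inner_dilate_avg dilate_avg_orthogonal[OF p u])
  finally have "real p * (\<Sum>h\<in>K. ?N h) \<le> real (card K) * sq_norm u" by simp
  then show ?thesis
    using prime_gt_0_nat[OF p(1)] by (simp add: field_simps)
qed

text \<open>
  Each step replaces the current function by its image under \<open>P\<^sub>k\<close>; the discarded part is annihilated by
  \<open>P\<^sub>k\<close>, so its contribution to the difference is at most zero.
\<close>

lemma sum_sq_norm_dilate_avg_defect:
  assumes p: "Factorial_Ring.prime p" "CHAR('a) = p"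
    and K: "add_subgroup K" and ks: "set ks \<subseteq> K"
  shows "(\<Sum>h\<in>K. sq_norm (dilate_avg G h f)) - real (card K) / real p * sq_norm f
    \<le> (\<Sum>h\<in>K. sq_norm (dilate_avg G h (foldr (dilate_avg G) ks f)))
        - real (card K) / real p * sq_norm (foldr (dilate_avg G) ks f)"
  using ks
proof (induction ks)
  case (Cons k ks)
  define F where "F = foldr (dilate_avg G) ks f"
  let ?P = "dilate_avg G k F"
  let ?u = "\<lambda>w. F w - ?P w"
  \<comment> \<open>Pythagoras for the projection with factor \<open>k\<close>, applied to the
    average of \<open>F\<close> with factor \<open>h\<close>; the two projections commute.\<close>
  have "sq_norm (dilate_avg G h F) = sq_norm (dilate_avg G h ?P) + sq_norm (dilate_avg G h ?u)" for h
    using sq_norm_dilate_avg_split[of "dilate_avg G h F" k]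
    by (simp add: dilate_avg_diff dilate_avg_commute[of G k G h])
  then have *: "(\<Sum>h\<in>K. sq_norm (dilate_avg G h F)) =
     (\<Sum>h\<in>K. sq_norm (dilate_avg G h ?P)) + (\<Sum>h\<in>K. sq_norm (dilate_avg G h ?u))"
    by (simp add: sum.distrib)
  have "(\<Sum>h\<in>K. sq_norm (dilate_avg G h ?u)) \<le> real (card K) / real p * sq_norm ?u"
    using Cons.prems by (intro sum_sq_norm_dilate_avg_le_of_null[OF p K, of k])
      (auto simp: dilate_avg_diff dilate_avg_idem)
  moreover have "real (card K) / real p * sq_norm F =
      real (card K) / real p * sq_norm ?P + real (card K) / real p * sq_norm ?u"
    by (simp add: sq_norm_dilate_avg_split[of F k] distrib_left)
  moreover have "(\<Sum>h\<in>K. sq_norm (dilate_avg G h f)) - real (card K) / real p * sq_norm f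
    \<le> (\<Sum>h\<in>K. sq_norm (dilate_avg G h F)) - real (card K) / real p * sq_norm F"
    unfolding F_def using Cons by simp
  ultimately show ?case
    using * by (simp add: F_def)
qed simp

end

section \<open>Invariance under the span and the bound for averages\<close>

inductive_set dilate_span :: "'a::field set \<Rightarrow> 'a set \<Rightarrow> 'a set" for K G where
  zero: "0 \<in> dilate_span K G"
| step: "v \<in> dilate_span K G \<Longrightarrow> k \<in> K \<Longrightarrow> g \<in> G \<Longrightarrow> v + k * g \<in> dilate_span K G"

lemma foldr_dilate_avg_commute:
  "dilate_avg G h (foldr (dilate_avg L) ks f) = foldr (dilate_avg L) ks (dilate_avg G h f)"
  by (induction ks) (simp_all add: dilate_avg_commute[of G h])

lemma foldr_dilate_avg_zero: "foldr (dilate_avg L) ks (\<lambda>w. 0) = (\<lambda>w. 0)"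
  by (induction ks) (simp_all add: dilate_avg_zero)

text \<open>The averages commute, so the one with factor \<open>k\<close> can be treated as the
  outermost. In the induction the head average is pushed into \<open>f\<close>, hence the
  generalization over \<open>f\<close>.\<close>

lemma (in add_subgroup) foldr_dilate_avg_invariant:
  assumes "k \<in> set ks" "g \<in> G"
  shows "foldr (dilate_avg G) ks f (w + k * g) = foldr (dilate_avg G) ks f w"
  using assms
proof (induction ks arbitrary: f)
  case (Cons a ks)
  show ?case
  proof (cases "k = a")
    case True
    then show ?thesis using dilate_avg_invariant[OF Cons.prems(2)] by simp
  next
    case False
    then show ?thesis using Cons by (simp add: foldr_dilate_avg_commute)
  qed
qed simp

text \<open>Averaging with every factor in \<open>K\<close> makes \<open>F\<close> invariant under
  the whole span. Then \<open>F\<close> equals its own mean over \<open>V\<close>, which is zero by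
  the hypothesis on \<open>f\<close>, and the final defect vanishes.\<close>

theorem (in add_subgroup) sum_sq_norm_dilate_avg_le:
  assumes p: "Factorial_Ring.prime p" "CHAR('a) = p" and K: "add_subgroup K"
    and V: "add_subgroup V" "V \<subseteq> dilate_span K G"
    and f: "dilate_avg V 1 f = (\<lambda>w. 0)"
  shows "(\<Sum>h\<in>K. sq_norm (dilate_avg G h f)) \<le> real (card K) / real p * sq_norm f"
proof -
  obtain ks where ks: "set ks = K" using finite_list[of K] by auto
  define F where "F = foldr (dilate_avg G) ks f"
  have step: "F (w + k * g) = F w" if "k \<in> K" "g \<in> G" for w k g
    using foldr_dilate_avg_invariant that ks by (simp add: F_def)
  have inv: "F (w + v) = F w" if "v \<in> dilate_span K G" for v w
    using that by induction (auto simp: step add.assoc[symmetric])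
  have "F = dilate_avg V 1 F"
    using inv V(2) by (subst add_subgroup.dilate_avg_eqI[OF V(1)]) auto
  also have "\<dots> = (\<lambda>w. 0)"
    by (simp add: F_def foldr_dilate_avg_commute f foldr_dilate_avg_zero)
  finally have "F = (\<lambda>w. 0)" .
  then show ?thesis
    using sum_sq_norm_dilate_avg_defect[OF p K, of ks f] ks
    by (simp add: F_def[symmetric] dilate_avg_zero sq_norm_def)
qed

section \<open>The normalized operator of a finite coset graph\<close>

text \<open>Makes the set whose supremum defines \<open>sigma2\<close> nonempty; a real
  \<open>Sup\<close> of the empty set carries no information.\<close>

lemma ex_unit_orthogonal_const:
  assumes "finite S" "a \<in> S" "b \<in> S" "a \<noteq> b"
  shows "\<exists>f. l2_inner S f (\<lambda>_. 1) = 0 \<and> l2_norm S f = 1"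
proof (intro exI conjI)
  define f :: "'a \<Rightarrow> complex" where
    "f x = (if x = a then of_real (1 / sqrt 2) else 0) - (if x = b then of_real (1 / sqrt 2) else 0)" for x
  show "l2_inner S f (\<lambda>_. 1) = 0"
    using assms by (simp add: l2_inner_def f_def sum_subtractf)
  have "(cmod (f x))\<^sup>2 = (if x = a then 1/2 else 0) + (if x = b then 1/2 else 0)" for x
    using assms(4) by (auto simp: f_def power_divide norm_divide)
  then show "l2_norm S f = 1"
    using assms by (simp add: l2_norm_def L2_set_def sum.distrib)
qed

text \<open>At a coset \<open>U\<close> of \<open>L\<close> the operator returns the sum of
  \<open>f (H #> \<phi>)\<close> over \<open>\<phi> \<in> U\<close>, divided by the root of
  \<open>card L * card H\<close>. Summing over group elements instead of cosets counts each
  \<open>U\<close> exactly \<open>card L\<close> times, whence the square of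
  \<open>card L\<close>.\<close>

lemma (in group) l2_norm_normalized_op:
  assumes fin: "finite (carrier G)" and L: "subgroup L G" and H: "subgroup H G"
  shows "(l2_norm (left_verts (coset_graph G L H)) (normalized_op G L H f))\<^sup>2 =
    (\<Sum>\<phi>\<in>carrier G. (cmod (\<Sum>g\<in>L. f (H #> (g \<otimes> \<phi>))))\<^sup>2) / (real (card L) ^ 2 * real (card H))"
proof -
  define c where "c = real (card L) * real (card H)"
  define F where "F U = {\<phi> \<in> carrier G. L #> \<phi> = U}" for U
  have finF: "finite (F U)" for U using fin by (simp add: F_def)
  have finL: "finite L" using L fin subgroup.subset finite_subset by metis
  have finR: "finite (rcosets K)" for K using fin by (simp add: RCOSETS_def)
  have pos: "card L > 0"
    using subgroup.one_closed[OF L] finL by (auto simp: card_gt_0_iff)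
  have S: "normalized_op G L H f U = of_real (1 / sqrt c) * (\<Sum>\<phi>\<in>F U. f (H #> \<phi>))" for U
  proof -
    \<comment> \<open>Matrix entries count the elements of \<open>U\<close> with a given right coset
      of \<open>H\<close>.\<close>
    have "(\<Sum>V\<in>rcosets H. of_nat (card {e \<in> carrier G. L #> e = U \<and> H #> e = V}) * f V)
       = (\<Sum>V\<in>rcosets H. \<Sum>\<phi> | \<phi> \<in> F U \<and> H #> \<phi> = V. f (H #> \<phi>))"
      by (intro sum.cong) (auto simp: F_def conj_assoc)
    also have "\<dots> = (\<Sum>\<phi>\<in>F U. f (H #> \<phi>))"
      using finF finR by (intro sum.group) (auto simp: F_def RCOSETS_def)
    finally show ?thesis
      by (simp add: normalized_op_def coset_graph_def biadjacency_def c_def)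
  qed
  have FL: "F (L #> \<phi>) = L #> \<phi>" if "\<phi> \<in> carrier G" for \<phi>
    using that L repr_independence[OF _ _ L] rcos_self[OF _ L] r_coset_subset_G[OF subgroup.subset[OF L]]
    unfolding F_def by blast
  have cos: "L #> \<phi> = (\<lambda>g. g \<otimes> \<phi>) ` L" for \<phi>
    by (auto simp: r_coset_def)
  have inj: "inj_on (\<lambda>g. g \<otimes> \<phi>) L" if "\<phi> \<in> carrier G" for \<phi>
    using that r_cancel subgroup.mem_carrier[OF L] by (intro inj_onI) blast
  have sumF: "(\<Sum>\<psi>\<in>F U. k \<psi>) = (\<Sum>g\<in>L. k (g \<otimes> \<phi>))" if "\<phi> \<in> F U" for \<phi> U and k :: "'a \<Rightarrow> complex"
    using that FL[of \<phi>] by (auto simp: F_def cos sum.reindex[OF inj])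
  have cardF: "card (F U) = card L" if "U \<in> rcosets L" for U
    using that FL cos inj by (auto simp: RCOSETS_def card_image)
  have "(\<Sum>\<phi>\<in>carrier G. (cmod (\<Sum>g\<in>L. f (H #> (g \<otimes> \<phi>))))\<^sup>2)
     = (\<Sum>U\<in>rcosets L. \<Sum>\<phi> | \<phi> \<in> carrier G \<and> L #> \<phi> = U. (cmod (\<Sum>g\<in>L. f (H #> (g \<otimes> \<phi>))))\<^sup>2)"
    using fin finR by (intro sum.group[symmetric]) (auto simp: RCOSETS_def)
  also have "\<dots> = (\<Sum>U\<in>rcosets L. \<Sum>\<phi>\<in>F U. (cmod (\<Sum>\<psi>\<in>F U. f (H #> \<psi>)))\<^sup>2)"
  proof (intro sum.cong refl)
    fix U \<phi> assume "\<phi> \<in> F U"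
    then show "(cmod (\<Sum>g\<in>L. f (H #> (g \<otimes> \<phi>))))\<^sup>2 = (cmod (\<Sum>\<psi>\<in>F U. f (H #> \<psi>)))\<^sup>2"
      by (simp only: sumF[OF \<open>\<phi> \<in> F U\<close>])
  qed (simp add: F_def)
  also have "\<dots> = real (card L) * (\<Sum>U\<in>rcosets L. (cmod (\<Sum>\<psi>\<in>F U. f (H #> \<psi>)))\<^sup>2)"
    by (simp add: cardF sum_distrib_left)
  finally have eq: "(\<Sum>\<phi>\<in>carrier G. (cmod (\<Sum>g\<in>L. f (H #> (g \<otimes> \<phi>))))\<^sup>2)
     = real (card L) * (\<Sum>U\<in>rcosets L. (cmod (\<Sum>\<psi>\<in>F U. f (H #> \<psi>)))\<^sup>2)" .
  have "(l2_norm (left_verts (coset_graph G L H)) (normalized_op G L H f))\<^sup>2 =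
     (\<Sum>U\<in>rcosets L. (cmod (normalized_op G L H f U))\<^sup>2)"
    by (simp add: l2_norm_def L2_set_def sum_nonneg coset_graph_def)
  also have "\<dots> = (\<Sum>U\<in>rcosets L. (cmod (\<Sum>\<psi>\<in>F U. f (H #> \<psi>)))\<^sup>2 / c)"
    unfolding S norm_mult norm_of_real power_mult_distrib
    by (simp add: power_divide c_def)
  finally have "(l2_norm (left_verts (coset_graph G L H)) (normalized_op G L H f))\<^sup>2 =
    (\<Sum>U\<in>rcosets L. (cmod (\<Sum>\<psi>\<in>F U. f (H #> \<psi>)))\<^sup>2 / c)" .
  then show ?thesis
    unfolding eq using pos by (simp add: c_def power2_eq_square sum_divide_distrib[symmetric])
qed

lemma mult_AGL1 [simp]: "monoid.mult AGL1 = (\<circ>)"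
  by (simp add: AGL1_def)

subsection \<open>The coset graph as a family of averages\<close>

text \<open>The assumptions on \<open>K\<close> describe a subfield; \<open>inverse_mem\<close>
  includes zero since \<open>inverse 0 = 0\<close>.\<close>

locale affine_pair = add_subgroup G for G :: "'a::{field,finite} set" +
  fixes K :: "'a set"
  assumes K_add: "add_subgroup K"
    and one_mem: "1 \<in> K"
    and mult_mem: "x \<in> K \<Longrightarrow> y \<in> K \<Longrightarrow> x * y \<in> K"
    and inverse_mem: "x \<in> K \<Longrightarrow> inverse x \<in> K"
begin

abbreviation H where "H \<equiv> K - {0}"
abbreviation V where "V \<equiv> dilate_span K G"
abbreviation A where "A \<equiv> subgroup_generated AGL1 (translation_maps G \<union> scaling_maps H)"
text \<open>Translation comes first, so composing with a scaling on the left changes only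
  \<open>h\<close>, and \<open>w\<close> labels the right coset of the scalings.\<close>

abbreviation aff where "aff h w \<equiv> (\<lambda>x. h * (x + w))"

lemma V_add_mem: "w \<in> V \<Longrightarrow> v \<in> V \<Longrightarrow> v + w \<in> V"
  by (induction rule: dilate_span.induct) (auto simp: add.assoc[symmetric] dilate_span.step)

lemma V_mult_mem: "v \<in> V \<Longrightarrow> k \<in> K \<Longrightarrow> k * v \<in> V"
  by (induction rule: dilate_span.induct)
    (auto simp: dilate_span.zero distrib_left mult.assoc[symmetric] dilate_span.step mult_mem)

lemma V_uminus_mem: "v \<in> V \<Longrightarrow> - v \<in> V"
  using V_mult_mem[of v "- 1"] add_subgroup.uminus_mem[OF K_add one_mem] by simp

lemma V_add_subgroup: "add_subgroup V"
proof
  show "0 \<in> V" by (rule dilate_span.zero)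
  show "x - y \<in> V" if "x \<in> V" "y \<in> V" for x y
    using V_add_mem[OF V_uminus_mem[OF that(2)] that(1)] by simp
qed

lemma G_dilate_mem: "g \<in> G \<Longrightarrow> k \<in> K \<Longrightarrow> k * g \<in> V"
  using dilate_span.step[OF dilate_span.zero] by force

lemma aff_mem_AGL1: "h \<in> H \<Longrightarrow> aff h w \<in> carrier AGL1"
  using AGL1_I[of h "h * w"] by (simp add: distrib_left)

section \<open>The generated affine group\<close>

text \<open>The upper bound for \<open>A\<close>. Composing \<open>aff h w\<close> with
  \<open>aff k v\<close> rescales \<open>w\<close> by \<open>inverse k\<close>, so closure rests on
  \<open>V\<close> being stable under \<open>K\<close>.\<close>

lemma aff_subgroup: "subgroup ((\<lambda>(h, w). aff h w) ` (H \<times> V)) AGL1" (is "subgroup ?B _")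
proof (rule group.subgroupI[OF group_AGL1])
  show "?B \<subseteq> carrier AGL1" using aff_mem_AGL1 by auto
  show "?B \<noteq> {}" using one_mem dilate_span.zero by force
next
  fix \<phi> assume "\<phi> \<in> ?B"
  then obtain h w where \<phi>: "\<phi> = aff h w" "h \<in> H" "w \<in> V" by auto
  have m: "aff (inverse h) (- (h * w)) \<in> ?B"
    using \<phi> inverse_mem V_uminus_mem V_mult_mem by force
  have eq: "aff (inverse h) (- (h * w)) \<otimes>\<^bsub>AGL1\<^esub> \<phi> = \<one>\<^bsub>AGL1\<^esub>"
    using \<phi> by (auto simp: AGL1_def fun_eq_iff field_simps)
  have \<phi>_mem: "\<phi> \<in> carrier AGL1"
    unfolding \<phi>(1) by (rule aff_mem_AGL1[OF \<phi>(2)])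
  have "aff (inverse h) (- (h * w)) \<in> carrier AGL1"
    by (rule aff_mem_AGL1) (use \<phi>(2) inverse_mem in auto)
  then have "inv\<^bsub>AGL1\<^esub> \<phi> = aff (inverse h) (- (h * w))"
    by (rule group.inv_equality[OF group_AGL1 eq \<phi>_mem])
  then show "inv\<^bsub>AGL1\<^esub> \<phi> \<in> ?B" using m by simp
next
  fix \<phi> \<psi> assume "\<phi> \<in> ?B" "\<psi> \<in> ?B"
  then obtain h w k v where *: "\<phi> = aff h w" "h \<in> H" "w \<in> V" "\<psi> = aff k v" "k \<in> H" "v \<in> V" by auto
  have "\<phi> \<otimes>\<^bsub>AGL1\<^esub> \<psi> = aff (h * k) (v + inverse k * w)"
    using * by (auto simp: AGL1_def fun_eq_iff field_simps)
  moreover have "h * k \<in> H" "v + inverse k * w \<in> V"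
    using * mult_mem V_add_mem V_mult_mem inverse_mem by auto
  ultimately show "\<phi> \<otimes>\<^bsub>AGL1\<^esub> \<psi> \<in> ?B" by force
qed

lemma mult_A: "\<phi> \<otimes>\<^bsub>A\<^esub> \<psi> = \<phi> \<circ> \<psi>"
  by simp

lemma group_A: "group A"
  by (rule group.group_subgroup_generated[OF group_AGL1])

lemma generators_subset_AGL1: "translation_maps G \<union> scaling_maps H \<subseteq> carrier AGL1"
  using AGL1_I[of 1] AGL1_I[of _ 0] by (auto simp: translation_maps_def scaling_maps_def)

lemma generators_subset_A: "translation_maps G \<union> scaling_maps H \<subseteq> carrier A"
  by (rule group.subgroup_generated_subset_carrier_subset[OF group_AGL1 generators_subset_AGL1])

lemma comp_mem_A: "\<phi> \<in> carrier A \<Longrightarrow> \<psi> \<in> carrier A \<Longrightarrow> \<phi> \<circ> \<psi> \<in> carrier A"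
  using monoid.m_closed[OF group.is_monoid[OF group_A], of \<phi> \<psi>] by (simp only: mult_A)

lemma scaling_mem_A: "h \<in> H \<Longrightarrow> (\<lambda>x. h * x) \<in> carrier A"
  using generators_subset_A by (auto simp: scaling_maps_def)

text \<open>Conjugating the translation by \<open>g\<close> with the scaling by a nonzero
  \<open>k\<close> gives the translation by \<open>k g\<close>; compositions of these reach all of
  \<open>V\<close>.\<close>

lemma translation_mem_A: "v \<in> V \<Longrightarrow> (\<lambda>x. x + v) \<in> carrier A"
proof (induction rule: dilate_span.induct)
  case zero
  then show ?case using scaling_mem_A[of 1] one_mem by simp
next
  case (step v k g)
  show ?case
  proof (cases "k = 0")
    case False
    then have k: "k \<in> H" "inverse k \<in> H" using step inverse_mem by auto
    have "(\<lambda>x. x + g) \<in> carrier A"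
      using step(3) generators_subset_A by (auto simp: translation_maps_def)
    then have "((\<lambda>x. k * x) \<circ> ((\<lambda>x. x + g) \<circ> (\<lambda>x. inverse k * x))) \<circ> (\<lambda>x. x + v) \<in> carrier A"
      by (intro comp_mem_A scaling_mem_A k step.IH)
    also have "((\<lambda>x. k * x) \<circ> ((\<lambda>x. x + g) \<circ> (\<lambda>x. inverse k * x))) \<circ> (\<lambda>x. x + v) = (\<lambda>x. x + (v + k * g))"
      using False by (auto simp: fun_eq_iff field_simps)
    finally show ?thesis .
  qed (use step in simp)
qed

lemma carrier_A: "carrier A = (\<lambda>(h, w). aff h w) ` (H \<times> V)"
proof
  have "translation_maps G \<subseteq> (\<lambda>(h, w). aff h w) ` (H \<times> V)"
    using G_dilate_mem[OF _ one_mem] one_mem by (force simp: translation_maps_def)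
  moreover have "scaling_maps H \<subseteq> (\<lambda>(h, w). aff h w) ` (H \<times> V)"
    using dilate_span.zero by (force simp: scaling_maps_def)
  ultimately show "carrier A \<subseteq> (\<lambda>(h, w). aff h w) ` (H \<times> V)"
    by (intro group.subgroup_generated_minimal[OF group_AGL1 aff_subgroup]) auto
next
  show "(\<lambda>(h, w). aff h w) ` (H \<times> V) \<subseteq> carrier A"
    using comp_mem_A[OF scaling_mem_A translation_mem_A] by (auto simp: comp_def)
qed

lemma aff_inj:
  fixes h w k v :: 'a
  assumes eq: "aff h w = aff k v" and h: "h \<noteq> 0"
  shows "h = k \<and> w = v"
proof -
  have "h * w = k * v" "h * (1 + w) = k * (1 + v)"
    using fun_cong[OF eq, of 0] fun_cong[OF eq, of 1] by auto
  then have "h = k" by (simp add: distrib_left)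
  with \<open>h * w = k * v\<close> h show ?thesis by simp
qed

lemma finite_A: "finite (carrier A)"
  by (simp add: carrier_A)

lemma subgroup_translation: "subgroup (translation_maps G) A"
proof -
  have "subgroup (translation_maps G) AGL1"
  proof (rule group.subgroupI[OF group_AGL1])
    show "translation_maps G \<subseteq> carrier AGL1" using generators_subset_AGL1 by simp
    show "translation_maps G \<noteq> {}" using zero_mem by (auto simp: translation_maps_def)
  next
    fix \<phi> :: "'a \<Rightarrow> 'a" assume "\<phi> \<in> translation_maps G"
    then obtain g where g: "\<phi> = (\<lambda>x. x + g)" "g \<in> G" by (auto simp: translation_maps_def)
    have "inv\<^bsub>AGL1\<^esub> \<phi> = (\<lambda>x. x + - g)"
      using g AGL1_I[of 1 g] AGL1_I[of 1 "- g"] by (intro group.inv_equality[OF group_AGL1]) (simp_all add: AGL1_def fun_eq_iff)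
    then show "inv\<^bsub>AGL1\<^esub> \<phi> \<in> translation_maps G"
      using uminus_mem[OF g(2)] unfolding translation_maps_def by (intro image_eqI[of _ _ "- g"])
  next
    fix \<phi> \<psi> :: "'a \<Rightarrow> 'a" assume "\<phi> \<in> translation_maps G" "\<psi> \<in> translation_maps G"
    then obtain g h where "\<phi> = (\<lambda>x. x + g)" "\<psi> = (\<lambda>x. x + h)" "g \<in> G" "h \<in> G"
      by (auto simp: translation_maps_def)
    then show "\<phi> \<otimes>\<^bsub>AGL1\<^esub> \<psi> \<in> translation_maps G"
      using add_mem[of h g] by (auto simp: translation_maps_def AGL1_def comp_def add.assoc)
  qed
  then show ?thesis
    using generators_subset_A group.subgroup_of_subgroup_generated[OF group_AGL1] by blast
qed

lemma subgroup_scaling: "subgroup (scaling_maps H) A"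
proof -
  have "subgroup (scaling_maps H) AGL1"
  proof (rule group.subgroupI[OF group_AGL1])
    show "scaling_maps H \<subseteq> carrier AGL1" using generators_subset_AGL1 by simp
    show "scaling_maps H \<noteq> {}" using one_mem by (auto simp: scaling_maps_def)
  next
    fix \<phi> :: "'a \<Rightarrow> 'a" assume "\<phi> \<in> scaling_maps H"
    then obtain h where h: "\<phi> = (\<lambda>x. h * x)" "h \<in> H" by (auto simp: scaling_maps_def)
    have "inv\<^bsub>AGL1\<^esub> \<phi> = (\<lambda>x. inverse h * x)"
      using h AGL1_I[of _ 0] by (intro group.inv_equality[OF group_AGL1]) (auto simp: AGL1_def fun_eq_iff)
    then show "inv\<^bsub>AGL1\<^esub> \<phi> \<in> scaling_maps H"
      using inverse_mem h(2) by (auto simp: scaling_maps_def)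
  next
    fix \<phi> \<psi> :: "'a \<Rightarrow> 'a" assume "\<phi> \<in> scaling_maps H" "\<psi> \<in> scaling_maps H"
    then obtain g h where "\<phi> = (\<lambda>x. g * x)" "\<psi> = (\<lambda>x. h * x)" "g \<in> H" "h \<in> H"
      by (auto simp: scaling_maps_def)
    then show "\<phi> \<otimes>\<^bsub>AGL1\<^esub> \<psi> \<in> scaling_maps H"
      using mult_mem[of g h] by (auto simp: scaling_maps_def AGL1_def comp_def mult.assoc[symmetric])
  qed
  then show ?thesis
    using generators_subset_A group.subgroup_of_subgroup_generated[OF group_AGL1] by blast
qed

section \<open>Cosets of the scalings as points of the span\<close>

lemma inj_translation: "inj_on (\<lambda>a x. x + a) (G :: 'a set)"
  by (intro inj_onI) (metis add_left_cancel)

lemma sum_translation_maps: "(\<Sum>\<gamma>\<in>translation_maps G. k \<gamma>) = (\<Sum>g\<in>G. k (\<lambda>x. x + g))"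
  unfolding translation_maps_def by (simp add: sum.reindex[OF inj_translation])

lemma card_translation_maps: "card (translation_maps G) = card G"
  unfolding translation_maps_def by (rule card_image[OF inj_translation])

lemma card_scaling_maps: "card (scaling_maps H) = card H"
  unfolding scaling_maps_def by (intro card_image inj_onI) (metis mult.right_neutral)

text \<open>The right coset of the scalings through the translation by \<open>w\<close>.\<close>

definition scaling_coset :: "'a \<Rightarrow> ('a \<Rightarrow> 'a) set" where
  "scaling_coset w = (\<lambda>h. aff h w) ` H"

lemma r_coset_aff:
  assumes "h \<in> H"
  shows "scaling_maps H #>\<^bsub>A\<^esub> aff h w = scaling_coset w"
proof -
  have "scaling_maps H #>\<^bsub>A\<^esub> aff h w = (\<lambda>k. aff (k * h) w) ` H"
    by (auto simp: r_coset_def scaling_maps_def comp_def mult.assoc)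
  also have "\<dots> = (\<lambda>k. aff k w) ` ((\<lambda>k. k * h) ` H)"
    by (simp add: image_image)
  also have "(\<lambda>k. k * h) ` H = H"
  proof
    show "(\<lambda>k. k * h) ` H \<subseteq> H" using assms mult_mem by auto
    show "H \<subseteq> (\<lambda>k. k * h) ` H"
    proof
      fix k assume "k \<in> H"
      then have "k = (k * inverse h) * h" "k * inverse h \<in> H"
        using assms mult_mem inverse_mem by auto
      then show "k \<in> (\<lambda>k. k * h) ` H" by blast
    qed
  qed
  finally show ?thesis by (simp add: scaling_coset_def)
qed

lemma bij_betw_scaling_coset: "bij_betw scaling_coset V (rcosets\<^bsub>A\<^esub> scaling_maps H)"
proof (rule bij_betw_imageI)
  show "inj_on scaling_coset V"
  proof (rule inj_onI)
    fix v w assume "scaling_coset v = scaling_coset w"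
    moreover have "aff 1 v \<in> scaling_coset v" using one_mem unfolding scaling_coset_def by (intro imageI) simp
    ultimately obtain h where "aff 1 v = aff h w" by (auto simp: scaling_coset_def)
    then show "v = w" using aff_inj[of 1 v h w] by simp
  qed
  have "rcosets\<^bsub>A\<^esub> scaling_maps H = (\<lambda>\<phi>. scaling_maps H #>\<^bsub>A\<^esub> \<phi>) ` carrier A"
    by (auto simp: RCOSETS_def)
  also have "\<dots> = (\<lambda>(h, w). scaling_maps H #>\<^bsub>A\<^esub> aff h w) ` (H \<times> V)"
    unfolding carrier_A by (simp add: image_image case_prod_unfold)
  also have "\<dots> = (\<lambda>(h, w). scaling_coset w) ` (H \<times> V)"
    by (intro image_cong) (auto simp: r_coset_aff)
  also have "\<dots> = scaling_coset ` V"
    using one_mem by force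
  finally show "scaling_coset ` V = rcosets\<^bsub>A\<^esub> scaling_maps H" by simp
qed

text \<open>
  Right cosets of the scalings correspond to elements of \<open>V\<close>; extending by zero outside \<open>V\<close> lets all sums
  range over the whole field.
\<close>

definition lift :: "(('a \<Rightarrow> 'a) set \<Rightarrow> complex) \<Rightarrow> 'a \<Rightarrow> complex" where
  "lift f w = (if w \<in> V then f (scaling_coset w) else 0)"

lemma sq_norm_lift: "sq_norm (lift f) = (l2_norm (rcosets\<^bsub>A\<^esub> scaling_maps H) f)\<^sup>2"
proof -
  have "sq_norm (lift f) = (\<Sum>w\<in>V. (cmod (f (scaling_coset w)))\<^sup>2)"
    unfolding sq_norm_def by (rule sum.mono_neutral_cong_right) (auto simp: lift_def)
  also have "\<dots> = (\<Sum>C\<in>rcosets\<^bsub>A\<^esub> scaling_maps H. (cmod (f C))\<^sup>2)"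
    by (rule sum.reindex_bij_betw[OF bij_betw_scaling_coset])
  finally show ?thesis by (simp add: l2_norm_def L2_set_def sum_nonneg)
qed

text \<open>At a point of \<open>V\<close> the mean is, up to a factor, the inner product of
  \<open>f\<close> with 1. Outside \<open>V\<close> the translate \<open>w + V\<close> misses
  \<open>V\<close>, where alone \<open>lift f\<close> can be nonzero.\<close>

lemma dilate_avg_lift:
  assumes "l2_inner (rcosets\<^bsub>A\<^esub> scaling_maps H) f (\<lambda>_. 1) = 0"
  shows "dilate_avg V 1 (lift f) = (\<lambda>w. 0)"
proof
  interpret V: add_subgroup V by (rule V_add_subgroup)
  fix w
  show "dilate_avg V 1 (lift f) w = 0"
  proof (cases "w \<in> V")
    case True
    have "(\<Sum>v\<in>V. lift f (w + v)) = (\<Sum>v\<in>V. lift f v)"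
      using V.sum_shift[OF True, of "lift f"] by (simp add: add.commute)
    also have "\<dots> = (\<Sum>v\<in>V. f (scaling_coset v))"
      by (simp add: lift_def)
    also have "\<dots> = (\<Sum>C\<in>rcosets\<^bsub>A\<^esub> scaling_maps H. f C)"
      by (rule sum.reindex_bij_betw[OF bij_betw_scaling_coset])
    also have "\<dots> = 0" using assms by (simp add: l2_inner_def)
    finally show ?thesis by (simp add: dilate_avg_def)
  next
    case False
    then have "w + v \<notin> V" if "v \<in> V" for v
      using V.diff_mem[of "w + v" v] that by auto
    then show ?thesis by (simp add: dilate_avg_def lift_def)
  qed
qed

text \<open>Translating by \<open>g\<close> after \<open>aff h w\<close> is the same as replacing
  \<open>w\<close> by \<open>w + inverse h * g\<close>; this is where dilates of \<open>G\<close>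
  arise.\<close>

lemma sum_translation_coset:
  assumes "h \<in> H" "w \<in> V"
  shows "(\<Sum>\<gamma>\<in>translation_maps G. f (scaling_maps H #>\<^bsub>A\<^esub> (\<gamma> \<circ> aff h w)))
    = of_nat (card G) * dilate_avg G (inverse h) (lift f) w"
proof -
  have "(\<Sum>\<gamma>\<in>translation_maps G. f (scaling_maps H #>\<^bsub>A\<^esub> (\<gamma> \<circ> aff h w)))
     = (\<Sum>g\<in>G. f (scaling_maps H #>\<^bsub>A\<^esub> ((\<lambda>x. x + g) \<circ> aff h w)))"
    by (rule sum_translation_maps[of "\<lambda>\<gamma>. f (scaling_maps H #>\<^bsub>A\<^esub> (\<gamma> \<circ> aff h w))"])
  also have "\<dots> = (\<Sum>g\<in>G. lift f (w + inverse h * g))"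
  proof (rule sum.cong[OF refl])
    fix g assume g: "g \<in> G"
    have "(\<lambda>x. x + g) \<circ> aff h w = aff h (w + inverse h * g)"
      using assms by (simp add: comp_def fun_eq_iff field_simps)
    moreover have "w + inverse h * g \<in> V"
      by (rule dilate_span.step) (use assms g inverse_mem in auto)
    ultimately show "f (scaling_maps H #>\<^bsub>A\<^esub> ((\<lambda>x. x + g) \<circ> aff h w)) = lift f (w + inverse h * g)"
      by (simp only: r_coset_aff[OF assms(1)] lift_def if_True)
  qed
  also have "\<dots> = of_nat (card G) * dilate_avg G (inverse h) (lift f) w"
    using card_pos by (simp add: dilate_avg_def)
  finally show ?thesis .
qed

text \<open>An inequality because two ranges are enlarged: \<open>w\<close> runs over the field
  instead of \<open>V\<close>, and the term \<open>h = 0\<close> is added so that the factors form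
  an additive group, as the shifting argument requires.\<close>

lemma l2_norm_normalized_op_le:
  "(l2_norm (rcosets\<^bsub>A\<^esub> translation_maps G) (normalized_op A (translation_maps G) (scaling_maps H) f))\<^sup>2
    \<le> (\<Sum>h\<in>K. sq_norm (dilate_avg G h (lift f))) / real (card H)"
proof -
  have inj: "inj_on (\<lambda>(h, w). aff h w) (H \<times> V)"
    using aff_inj by (fastforce intro!: inj_onI)
  have "(\<Sum>\<phi>\<in>carrier A. (cmod (\<Sum>\<gamma>\<in>translation_maps G. f (scaling_maps H #>\<^bsub>A\<^esub> (\<gamma> \<circ> \<phi>))))\<^sup>2)
    = (\<Sum>(h, w)\<in>H \<times> V. (cmod (\<Sum>\<gamma>\<in>translation_maps G. f (scaling_maps H #>\<^bsub>A\<^esub> (\<gamma> \<circ> aff h w))))\<^sup>2)"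
    by (rule sum.reindex_cong[OF inj carrier_A]) (simp only: case_prod_unfold)
  also have "\<dots> = (\<Sum>(h, w)\<in>H \<times> V. (real (card G))\<^sup>2 * (cmod (dilate_avg G (inverse h) (lift f) w))\<^sup>2)"
  proof (rule sum.cong[OF refl])
    fix x assume "x \<in> H \<times> V"
    then have x: "fst x \<in> H" "snd x \<in> V" by auto
    show "(case x of (h, w) \<Rightarrow> (cmod (\<Sum>\<gamma>\<in>translation_maps G. f (scaling_maps H #>\<^bsub>A\<^esub> (\<gamma> \<circ> aff h w))))\<^sup>2)
        = (case x of (h, w) \<Rightarrow> (real (card G))\<^sup>2 * (cmod (dilate_avg G (inverse h) (lift f) w))\<^sup>2)"
      unfolding case_prod_unfold sum_translation_coset[OF x, of f]
      by (simp add: norm_mult power_mult_distrib)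
  qed
  also have "\<dots> = (real (card G))\<^sup>2 * (\<Sum>h\<in>H. \<Sum>w\<in>V. (cmod (dilate_avg G (inverse h) (lift f) w))\<^sup>2)"
    by (simp add: sum.cartesian_product[symmetric] sum_distrib_left)
  finally have total: "(\<Sum>\<phi>\<in>carrier A. (cmod (\<Sum>\<gamma>\<in>translation_maps G. f (scaling_maps H #>\<^bsub>A\<^esub> (\<gamma> \<circ> \<phi>))))\<^sup>2)
    = (real (card G))\<^sup>2 * (\<Sum>h\<in>H. \<Sum>w\<in>V. (cmod (dilate_avg G (inverse h) (lift f) w))\<^sup>2)" .
  have "(l2_norm (rcosets\<^bsub>A\<^esub> translation_maps G) (normalized_op A (translation_maps G) (scaling_maps H) f))\<^sup>2
    = (\<Sum>\<phi>\<in>carrier A. (cmod (\<Sum>\<gamma>\<in>translation_maps G. f (scaling_maps H #>\<^bsub>A\<^esub> (\<gamma> \<circ> \<phi>))))\<^sup>2)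
      / ((real (card G))\<^sup>2 * real (card H))"
    using group.l2_norm_normalized_op[OF group_A finite_A subgroup_translation subgroup_scaling, of f]
    unfolding mult_A card_translation_maps card_scaling_maps by (simp add: coset_graph_def)
  also have "\<dots> = (\<Sum>h\<in>H. \<Sum>w\<in>V. (cmod (dilate_avg G (inverse h) (lift f) w))\<^sup>2) / real (card H)"
    unfolding total using zero_mem by auto
  also have "\<dots> \<le> (\<Sum>h\<in>K. sq_norm (dilate_avg G h (lift f))) / real (card H)"
  proof (rule divide_right_mono)
    have "(\<Sum>h\<in>H. \<Sum>w\<in>V. (cmod (dilate_avg G (inverse h) (lift f) w))\<^sup>2)
       \<le> (\<Sum>h\<in>H. sq_norm (dilate_avg G (inverse h) (lift f)))"
      unfolding sq_norm_def by (rule sum_mono, rule sum_mono2) auto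
    \<comment> \<open>Inversion permutes \<open>H\<close>.\<close>
    also have "\<dots> = (\<Sum>h\<in>H. sq_norm (dilate_avg G h (lift f)))"
      by (rule sum.reindex_bij_witness[of _ inverse inverse]) (auto simp: inverse_mem)
    also have "\<dots> \<le> (\<Sum>h\<in>K. sq_norm (dilate_avg G h (lift f)))"
      by (rule sum_mono2) (auto simp: sq_norm_nonneg)
    finally show "(\<Sum>h\<in>H. \<Sum>w\<in>V. (cmod (dilate_avg G (inverse h) (lift f) w))\<^sup>2)
      \<le> (\<Sum>h\<in>K. sq_norm (dilate_avg G h (lift f)))" .
  qed simp
  finally show ?thesis .
qed

text \<open>The bound on averages contributes \<open>card K / p\<close>, the mean over
  \<open>H\<close> the divisor \<open>card K - 1\<close>. A nonzero \<open>g\<close> yields two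
  distinct cosets, hence a unit vector orthogonal to the constants.\<close>

theorem coset_graph_sigma2_le:
  assumes p: "Factorial_Ring.prime p" "CHAR('a) = p" and G: "g \<in> G" "g \<noteq> 0"
  shows "coset_graph_sigma2 A (translation_maps G) (scaling_maps H)
    \<le> sqrt (real (card K) / (real p * (real (card K) - 1)))"
proof -
  let ?R = "rcosets\<^bsub>A\<^esub> scaling_maps H"
  let ?T = "normalized_op A (translation_maps G) (scaling_maps H)"
  have cardH: "real (card H) = real (card K) - 1"
    using add_subgroup.zero_mem[OF K_add] add_subgroup.card_pos[OF K_add] by (simp add: of_nat_diff Suc_leI)
  have bound: "l2_norm (rcosets\<^bsub>A\<^esub> translation_maps G) (?T f)
      \<le> sqrt (real (card K) / (real p * (real (card K) - 1)))"
    if f: "l2_inner ?R f (\<lambda>_. 1) = 0" "l2_norm ?R f = 1" for f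
  proof (rule real_le_rsqrt)
    have "(l2_norm (rcosets\<^bsub>A\<^esub> translation_maps G) (?T f))\<^sup>2
        \<le> (\<Sum>h\<in>K. sq_norm (dilate_avg G h (lift f))) / real (card H)"
      by (rule l2_norm_normalized_op_le)
    also have "\<dots> \<le> (real (card K) / real p * sq_norm (lift f)) / real (card H)"
      by (intro divide_right_mono sum_sq_norm_dilate_avg_le[OF p K_add V_add_subgroup subset_refl]
          dilate_avg_lift f) simp
    finally show "(l2_norm (rcosets\<^bsub>A\<^esub> translation_maps G) (?T f))\<^sup>2
        \<le> real (card K) / (real p * (real (card K) - 1))"
      by (simp only: sq_norm_lift f cardH) simp
  qed
  have "g \<in> V" using G_dilate_mem[OF G(1) one_mem] by simp
  have "scaling_coset g \<noteq> scaling_coset 0"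
  proof
    assume "scaling_coset g = scaling_coset 0"
    then have "g = 0"
      by (rule inj_onD[OF bij_betw_imp_inj_on[OF bij_betw_scaling_coset] _ \<open>g \<in> V\<close> dilate_span.zero])
    with G(2) show False by simp
  qed
  moreover have "scaling_coset g \<in> ?R"
    by (rule bij_betw_apply[OF bij_betw_scaling_coset \<open>g \<in> V\<close>])
  moreover have "scaling_coset 0 \<in> ?R"
    by (rule bij_betw_apply[OF bij_betw_scaling_coset dilate_span.zero])
  moreover have "finite ?R" using finite_A by (simp add: RCOSETS_def)
  ultimately obtain f where f: "l2_inner ?R f (\<lambda>_. 1) = 0 \<and> l2_norm ?R f = 1"
    using ex_unit_orthogonal_const[of ?R "scaling_coset g" "scaling_coset 0"] by metis
  have "Sup {l2_norm (rcosets\<^bsub>A\<^esub> translation_maps G) (?T f) | f. l2_inner ?R f (\<lambda>_. 1) = 0 \<and> l2_norm ?R f = 1}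
      \<le> sqrt (real (card K) / (real p * (real (card K) - 1)))" (is "Sup ?S \<le> ?b")
  proof (rule cSup_least)
    show "?S \<noteq> {}" using f by blast
    fix x assume "x \<in> ?S"
    then obtain f where "x = l2_norm (rcosets\<^bsub>A\<^esub> translation_maps G) (?T f)"
      "l2_inner ?R f (\<lambda>_. 1) = 0" "l2_norm ?R f = 1" by (elim CollectE exE conjE)
    then show "x \<le> ?b" using bound by (simp only:)
  qed
  then show ?thesis
    by (simp only: coset_graph_sigma2_def sigma2_def coset_graph_def bipartite_multigraph.simps)
qed

end

section \<open>The subfield and the roots of the given polynomial\<close>

lemma subfield_ring_of_type_algebra:
  fixes K :: "'a::{field,finite} set"
  assumes "subfield K (ring_of_type_algebra :: 'a ring)"
  shows "add_subgroup K" "1 \<in> K" "x \<in> K \<Longrightarrow> y \<in> K \<Longrightarrow> x * y \<in> K" "x \<in> K \<Longrightarrow> inverse x \<in> K"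
proof -
  let ?R = "ring_of_type_algebra :: 'a ring"
  interpret R: ring ?R by (rule ring_from_type_algebra)
  have K: "subring K ?R" using subfieldE(1)[OF assms] .
  have ops [simp]: "\<zero>\<^bsub>?R\<^esub> = 0" "\<one>\<^bsub>?R\<^esub> = 1" "a \<oplus>\<^bsub>?R\<^esub> b = a + b" "a \<otimes>\<^bsub>?R\<^esub> b = a * b"
    "carrier ?R = UNIV" for a b
    by (simp_all add: ring_of_type_algebra_def)
  have uminus: "\<ominus>\<^bsub>?R\<^esub> a = - a" for a
    using R.minus_equality[of "- a" a] by simp
  note E = subringE[OF K, simplified]
  show "add_subgroup K"
  proof
    show "0 \<in> K" using E by simp
    show "x - y \<in> K" if "x \<in> K" "y \<in> K" for x y
      using E(7)[of x "- y"] E(5)[of y] that by (simp add: uminus)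
  qed
  show "1 \<in> K" "x \<in> K \<Longrightarrow> y \<in> K \<Longrightarrow> x * y \<in> K" using E by auto
  show "inverse x \<in> K" if "x \<in> K"
  proof (cases "x = 0")
    case False
    then have "inv\<^bsub>?R\<^esub> x \<in> K" "x * inv\<^bsub>?R\<^esub> x = 1"
      using R.subfield_m_inv[OF assms, of x] that by auto
    then show ?thesis using inverse_unique by metis
  qed (use that in simp)
qed

text \<open>If all roots were zero, \<open>P\<close> would be a scalar times a power of X; the
  nonzero linear coefficient forces exponent 1, against the degree.\<close>

lemma splits_ex_nonzero_root:
  fixes P :: "'a::field poly"
  assumes "splits P" "Polynomial.coeff P 1 \<noteq> 0" "Polynomial.degree P \<ge> 2"
  shows "\<exists>x. x \<noteq> 0 \<and> poly P x = 0"
proof (rule ccontr)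
  assume no: "\<not> ?thesis"
  obtain as where as: "P = Polynomial.smult (Polynomial.lead_coeff P) (\<Prod>a\<leftarrow>as. [:- a, 1:])"
    using assms(1) by (auto simp: splits_def)
  have "a = 0" if "a \<in> set as" for a
  proof (rule ccontr)
    assume "a \<noteq> 0"
    moreover have "poly (\<Prod>a\<leftarrow>as. [:- a, 1:]) a = 0"
      using that by (induction as) auto
    then have "poly P a = 0" by (subst as) simp
    ultimately show False using no by blast
  qed
  then have "(\<Prod>a\<leftarrow>as. [:- a, 1:]) = Polynomial.monom (1::'a) (length as)"
    by (induction as) (auto simp: Polynomial.monom_Suc Polynomial.monom_0 one_pCons)
  then have *: "P = Polynomial.monom (Polynomial.lead_coeff P) (length as)"
    using as by (simp add: Polynomial.smult_monom)
  have "length as = 1"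
    using assms(2) by (subst (asm) *) (simp split: if_splits)
  then have "Polynomial.degree P \<le> 1"
    by (subst *) (metis Polynomial.degree_monom_le)
  then show False using assms(3) by simp
qed

theorem theorem4p7:
  fixes m p :: nat
    and P :: "'a::{field,finite} poly"
    and G K H :: "'a set"
    and A :: "('a \<Rightarrow> 'a) monoid"
  assumes "m \<ge> 2" and "Factorial_Ring.prime p" and "CHAR('a) = p"
    and "P = Polynomial.monom 1 (p ^ m) + Polynomial.monom 1 p + Polynomial.monom 1 1"
    and "splits P"
    and "G = {x. poly P x = 0}"
    and "subfield K (ring_of_type_algebra :: 'a ring)" and "card K = p ^ m"
    and "H = K - {0}"
    and "A = subgroup_generated AGL1 (translation_maps G \<union> scaling_maps H)"
  shows "coset_graph_sigma2 A (translation_maps G) (scaling_maps H)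
           \<le> sqrt (1 / real p + 1 / (real p ^ m - 1))"
proof -
  have p: "p \<ge> 2" using assms(2) by (rule prime_ge_2_nat)
  have pm: "p < p ^ m"
    using power_strict_increasing[of 1 m p] p assms(1) by simp
  have polyP: "poly P x = x ^ (p ^ m) + x ^ p + x" for x
    by (simp add: assms(4) Polynomial.poly_monom)
  \<comment> \<open>All exponents are powers of the characteristic, so \<open>P\<close> is additive
    and its roots form an additive group.\<close>
  have additive: "poly P (x + y) = poly P x + poly P y" for x y
  proof -
    have "(x + y) ^ (p ^ m) = x ^ (p ^ m) + y ^ (p ^ m)"
      by (rule freshmans_dream') (use assms(2,3) in auto)
    moreover have "(x + y) ^ p = x ^ p + y ^ p"
      by (rule freshmans_dream) (use assms(2,3) in auto)
    ultimately show ?thesis by (simp add: polyP)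
  qed
  have P0: "poly P 0 = 0" using p by (simp add: polyP power_0_left)
  have sub: "add_subgroup G"
  proof
    show "0 \<in> G" by (simp add: assms(6) P0)
    show "x - y \<in> G" if "x \<in> G" "y \<in> G" for x y
      using additive[of "x - y" y] that by (simp add: assms(6))
  qed
  \<comment> \<open>The exponents \<open>p ^ m\<close>, \<open>p\<close> and 1 are distinct, so no
    coefficients merge.\<close>
  have "Polynomial.coeff P (p ^ m) = 1" "Polynomial.coeff P 1 = 1"
    using p pm assms(1) by (auto simp: assms(4))
  moreover from this(1) have "Polynomial.degree P \<ge> 2"
    using Polynomial.le_degree[of P "p ^ m"] pm p by simp
  ultimately obtain g where g: "g \<in> G" "g \<noteq> 0"
    using splits_ex_nonzero_root[OF assms(5)] assms(6) by auto
  interpret affine_pair G K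
    using sub subfield_ring_of_type_algebra[OF assms(7)]
    by (simp add: affine_pair_def affine_pair_axioms_def)
  have "1 < p ^ m" using pm p by simp
  then have q: "real p ^ m > 1" by (metis of_nat_1 of_nat_less_iff of_nat_power)
  have "real p ^ m / (real p * (real p ^ m - 1)) = 1 / real p + 1 / (real p * (real p ^ m - 1))"
    using p q by (simp add: field_simps)
  \<comment> \<open>Dropping the factor \<open>p\<close> from the second denominator weakens the
    bound to the stated one.\<close>
  also have "\<dots> \<le> 1 / real p + 1 / (real p ^ m - 1)"
    using p q by (intro add_left_mono divide_left_mono) auto
  finally have le: "real p ^ m / (real p * (real p ^ m - 1)) \<le> 1 / real p + 1 / (real p ^ m - 1)" .
  have "coset_graph_sigma2 A (translation_maps G) (scaling_maps H)
      \<le> sqrt (real p ^ m / (real p * (real p ^ m - 1)))"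
    using coset_graph_sigma2_le[OF assms(2,3) g] by (simp add: assms(8,9,10))
  also have "\<dots> \<le> sqrt (1 / real p + 1 / (real p ^ m - 1))"
    using le by (rule real_sqrt_le_mono)
  finally show ?thesis .
qed

end
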